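(* Let $p\ge1$ and let $\alpha_1,\dots,\alpha_p\in\mathbb C$ satisfy $\alpha_i-\alpha_h\notin\mathbb Z$ for $i\ne h$ and $\alpha_j+2\notin\{0,-1,-2,\dots\}$ for all $j$. With the notation of the context, let $T^{\mathrm{MB}}_{\mathrm{II}}$ be the recurrence matrix of the monic step-line type-II multiple Bessel polynomials $(P^{[0]}_n)_{n\ge0}$. Then $$T^{\mathrm{MB}}_{\mathrm{II}}=\widetilde L_1\cdots\widetilde L_p\,\widetilde U_1 ,$$ where each $\widetilde L_b$ ($1\le b\le p$) is lower bidiagonal with unit diagonal and subdiagonal entries $$(\widetilde L_b)_{n+1,n}=\frac{P^{[b-1]}_{n+1}(0)-P^{[b]}_{n+1}(0)}{P^{[b]}_n(0)} ,$$ equivalently, with $a=b-1$, $$(\widetilde L_b)_{n+1,n}=\left(\frac1{\theta_{a+n+1}+n+2}-\frac1{\theta_a+n+2}\right)\prod_{s=1}^n\frac{\theta_{a+s}+n+1}{\theta_{a+s}+n+2},$$ and $\widetilde U_1$ is upper bidiagonal with unit superdiagonal and diagonal entries $$(\widetilde U_1)_{n,n}=-\frac{P^{[0]}_{n+1}(0)}{P^{[0]}_n(0)}=\frac{\mathscr D_n(\boldsymbol\theta)\,\mathscr D_{n+1}(\boldsymbol\theta^{[p]})}{\mathscr D_{n+1}(\boldsymbol\theta)\,\mathscr D_n(\boldsymbol\theta^{[p]})} .$$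
   Context: This is the one-row case $q=1$, $r=0$, with $\alpha_j=b_1+\kappa_j$. Extend cyclically: $\alpha_{sp+j}=\alpha_j+s$ for $s\in\mathbb N_0$, $1\le j\le p$, and set $\theta_n=\alpha_{n+1}$, $n\in\mathbb N_0$ (so $\theta_{pu+j-1}=\alpha_j+u$). $\boldsymbol\theta=(\theta_0,\theta_1,\dots)$ and $\boldsymbol\theta^{[b]}=(\theta_b,\theta_{b+1},\dots)$; note $\boldsymbol\theta^{[p]}=(\theta_0+1,\theta_1+1,\dots)$. For $b\in\{0,\dots,p\}$, $P^{[b]}_n$ is the monic polynomial $P^{[b]}_n(z)=\sum_{s=0}^np^{[b]}_{n,s}z^s$, $p^{[b]}_{n,n}=1$, characterized by $\sum_{s=0}^np^{[b]}_{n,s}\dfrac1{\Gamma(\theta_{b+k}+s+2)}=0$ for $k\in\{0,\dots,n-1\}$. The recurrence matrix $T^{\mathrm{MB}}_{\mathrm{II}}=(T_{n,m})_{n,m\ge0}$ is defined by $zP^{[0]}_n(z)=\sum_mT_{n,m}P^{[0]}_m(z)$. All matrices are semi-infinite, indexed from $0$. For a sequence $\boldsymbol\vartheta$, $\mathscr D_0(\boldsymbol\vartheta)=1$ and $\mathscr D_n(\boldsymbol\vartheta)=(-1)^{n(n-1)/2}\dfrac{\prod_{0\le s<t<n}(\vartheta_t-\vartheta_s)}{\prod_{s=0}^{n-1}\Gamma(\vartheta_s+n+1)}$. *)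

theory Defs
  imports "HOL-Analysis.Analysis" "HOL-Computational_Algebra.Polynomial"
begin

text \<open>The parameters are \<open>\<alpha> 1, \<dots>, \<alpha> p\<close>; values of \<open>\<alpha>\<close> outside \<open>{1..p}\<close> are never used.
  The cyclic extension is only meaningful at indices \<open>i \<ge> 1\<close>.\<close>

definition alpha_ext :: "nat \<Rightarrow> (nat \<Rightarrow> complex) \<Rightarrow> nat \<Rightarrow> complex" where
  "alpha_ext p \<alpha> i = \<alpha> ((i - 1) mod p + 1) + of_nat ((i - 1) div p)"

lemma alpha_ext_cyclic:
  assumes "1 \<le> j" "j \<le> p"
  shows "alpha_ext p \<alpha> (s * p + j) = \<alpha> j + of_nat s"
proof -
  obtain i where i: "j = Suc i" "i < p"
    using assms by (cases j) auto
  show ?thesis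
    using i by (simp add: alpha_ext_def)
qed

definition theta :: "nat \<Rightarrow> (nat \<Rightarrow> complex) \<Rightarrow> nat \<Rightarrow> complex" where
  "theta p \<alpha> n = alpha_ext p \<alpha> (n + 1)"

definition theta_shift :: "nat \<Rightarrow> (nat \<Rightarrow> complex) \<Rightarrow> nat \<Rightarrow> nat \<Rightarrow> complex" where
  "theta_shift p \<alpha> b n = theta p \<alpha> (b + n)"

lemma theta_shift_p:
  assumes "p \<ge> 1"
  shows "theta_shift p \<alpha> p n = theta p \<alpha> n + 1"
  using assms by (simp add: theta_shift_def theta_def alpha_ext_def)

definition is_MB_poly :: "nat \<Rightarrow> (nat \<Rightarrow> complex) \<Rightarrow> nat \<Rightarrow> nat \<Rightarrow> complex poly \<Rightarrow> bool" where
  "is_MB_poly p \<alpha> b n P \<longleftrightarrow>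
     degree P = n \<and> coeff P n = 1 \<and>
     (\<forall>k<n. (\<Sum>s=0..n. coeff P s * (1 / Gamma (theta p \<alpha> (b + k) + of_nat s + 2))) = 0)"

definition MB_poly :: "nat \<Rightarrow> (nat \<Rightarrow> complex) \<Rightarrow> nat \<Rightarrow> nat \<Rightarrow> complex poly" where
  "MB_poly p \<alpha> b n = (THE P. is_MB_poly p \<alpha> b n P)"

type_synonym inf_matrix = "nat \<Rightarrow> nat \<Rightarrow> complex"

text \<open>Rows are required to have finite support, so that the expansion is a finite sum.\<close>

definition is_recurrence_matrix :: "(nat \<Rightarrow> complex poly) \<Rightarrow> inf_matrix \<Rightarrow> bool" where
  "is_recurrence_matrix P T \<longleftrightarrow>
     (\<forall>n. finite {m. T n m \<noteq> 0} \<and>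
          [:0, 1:] * P n = (\<Sum>m | T n m \<noteq> 0. smult (T n m) (P m)))"

definition T_MB :: "nat \<Rightarrow> (nat \<Rightarrow> complex) \<Rightarrow> inf_matrix" where
  "T_MB p \<alpha> = (THE T. is_recurrence_matrix (MB_poly p \<alpha> 0) T)"

text \<open>Matrix product for a left factor with finitely supported rows; it is only applied to
  bidiagonal left factors.\<close>

definition inf_mult :: "inf_matrix \<Rightarrow> inf_matrix \<Rightarrow> inf_matrix" where
  "inf_mult A B = (\<lambda>n m. \<Sum>k | A n k \<noteq> 0. A n k * B k m)"

definition lower_bidiagonal :: "(nat \<Rightarrow> complex) \<Rightarrow> inf_matrix" where
  "lower_bidiagonal c = (\<lambda>n m. if n = m then 1 else if n = m + 1 then c m else 0)"

definition upper_bidiagonal :: "(nat \<Rightarrow> complex) \<Rightarrow> inf_matrix" where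
  "upper_bidiagonal d = (\<lambda>n m. if n = m then d n else if m = n + 1 then 1 else 0)"

definition L_tilde :: "nat \<Rightarrow> (nat \<Rightarrow> complex) \<Rightarrow> nat \<Rightarrow> inf_matrix" where
  "L_tilde p \<alpha> b = lower_bidiagonal (\<lambda>n.
     (poly (MB_poly p \<alpha> (b - 1) (n + 1)) 0 - poly (MB_poly p \<alpha> b (n + 1)) 0)
       / poly (MB_poly p \<alpha> b n) 0)"

definition U_tilde :: "nat \<Rightarrow> (nat \<Rightarrow> complex) \<Rightarrow> inf_matrix" where
  "U_tilde p \<alpha> = upper_bidiagonal (\<lambda>n.
     - (poly (MB_poly p \<alpha> 0 (n + 1)) 0 / poly (MB_poly p \<alpha> 0 n) 0))"

text \<open>For \<open>n = 0\<close> all products are empty and the value is \<open>1\<close>.\<close>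

definition scrD :: "nat \<Rightarrow> (nat \<Rightarrow> complex) \<Rightarrow> complex" where
  "scrD n \<theta> = (-1) ^ (n * (n - 1) div 2) *
     ((\<Prod>t<n. \<Prod>s<t. \<theta> t - \<theta> s) / (\<Prod>s<n. Gamma (\<theta> s + of_nat n + 1)))"

lemma scrD_0: "scrD 0 \<theta> = 1"
  by (simp add: scrD_def)

end

theory Submission
  imports Defs
begin

text \<open>
  Write \<open>\<ell>\<^sub>y(f) = \<Sum>\<^sub>s f\<^sub>s / \<Gamma>(y + s + 2)\<close>. For \<open>deg f \<le> n\<close> the function \<open>y \<mapsto> \<Gamma>(y + n + 2) \<ell>\<^sub>y(f)\<close> is a
  polynomial in \<open>y\<close> of degree at most \<open>n\<close>, with leading coefficient \<open>f(0)\<close> and value \<open>f\<^sub>n\<close> at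
  \<open>y = -(n + 1)\<close>, and every such polynomial arises from exactly one \<open>f\<close>. For a multiple Bessel
  polynomial it is therefore a multiple of \<open>\<Prod>\<^sub>k (y - \<theta>\<^sub>k)\<close>, which gives existence, uniqueness and
  the value at \<open>0\<close>, and shows that a polynomial of degree at most \<open>n\<close> satisfying the \<open>n\<close>
  orthogonality conditions is determined by its value at \<open>0\<close>. Together with
  \<open>\<ell>\<^sub>y(z f) = \<ell>\<^sub>y\<^sub>+\<^sub>1(f)\<close>, this yields the connection formulas between neighbouring families
  that the bidiagonal factors encode.
\<close>

section \<open>Moments with reciprocal Gamma weights\<close>

text \<open>Using \<open>rGamma\<close>, an entire function, gives the recurrence in
  \<open>y\<close> without side conditions. Summing up to \<open>degree f\<close> keeps the
  functional free of a degree bound.\<close>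

definition gamma_moment :: "complex \<Rightarrow> complex poly \<Rightarrow> complex" where
  "gamma_moment y f = (\<Sum>s\<le>degree f. coeff f s * rGamma (y + of_nat s + 2))"

lemma gamma_moment_altdef:
  assumes "degree f \<le> n"
  shows "gamma_moment y f = (\<Sum>s\<le>n. coeff f s * rGamma (y + of_nat s + 2))"
  unfolding gamma_moment_def
  by (rule sum.mono_neutral_left) (use assms in \<open>auto simp: coeff_eq_0\<close>)

lemma gamma_moment_diff: "gamma_moment y (f - g) = gamma_moment y f - gamma_moment y g"
proof -
  define N where "N = max (degree f) (degree g)"
  have "degree f \<le> N" "degree g \<le> N" "degree (f - g) \<le> N"
    by (auto simp: N_def degree_diff_le_max)
  then show ?thesis
    by (simp add: gamma_moment_altdef[where n = N] sum_subtractf algebra_simps)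
qed

lemma gamma_moment_smult: "gamma_moment y (smult c f) = c * gamma_moment y f"
  by (simp add: gamma_moment_altdef[OF degree_smult_le] gamma_moment_def sum_distrib_left mult.assoc)

lemma gamma_moment_pCons_0: "gamma_moment y (pCons 0 f) = gamma_moment (y + 1) f"
proof -
  have "gamma_moment y (pCons 0 f)
      = (\<Sum>s\<le>Suc (degree f). coeff (pCons 0 f) s * rGamma (y + of_nat s + 2))"
    by (rule gamma_moment_altdef) (simp add: degree_pCons_le)
  also have "\<dots> = gamma_moment (y + 1) f"
    by (subst sum.atMost_Suc_shift) (simp add: gamma_moment_def algebra_simps)
  finally show ?thesis .
qed

text \<open>A Horner scheme for
  \<open>\<Sum>s\<le>n. coeff f s * (\<Prod>j=s..<n. y + j + 2)\<close>, where each product is the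
  Gamma quotient \<open>Gamma (y + n + 2) / Gamma (y + s + 2)\<close>. Only the coefficients up to
  \<open>n\<close> enter.\<close>

primrec moment_poly :: "nat \<Rightarrow> complex poly \<Rightarrow> complex poly" where
  "moment_poly 0 f = [:coeff f 0:]"
| "moment_poly (Suc n) f = [:of_nat n + 2, 1:] * moment_poly n f + [:coeff f (Suc n):]"

lemma sum_rGamma_eq_moment_poly:
  "(\<Sum>s\<le>n. coeff f s * rGamma (y + of_nat s + 2))
     = poly (moment_poly n f) y * rGamma (y + of_nat n + 2)"
proof (induction n)
  case (Suc n)
  have "rGamma (y + of_nat n + 2) = (y + of_nat n + 2) * rGamma (y + of_nat (Suc n) + 2)"
    using rGamma_plus1[of "y + of_nat n + 2"] by (simp add: algebra_simps)
  with Suc show ?case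
    by (simp add: algebra_simps)
qed simp

lemma gamma_moment_eq_moment_poly:
  assumes "degree f \<le> n"
  shows "gamma_moment y f = poly (moment_poly n f) y * rGamma (y + of_nat n + 2)"
  using gamma_moment_altdef[OF assms] sum_rGamma_eq_moment_poly by simp

lemma degree_moment_poly: "degree (moment_poly n f) \<le> n"
proof (induction n)
  case (Suc n)
  have "degree ([:of_nat n + 2, 1:] * moment_poly n f) \<le> Suc n"
    using degree_mult_le[of "[:of_nat n + 2, 1:]" "moment_poly n f"] Suc by simp
  then show ?case
    by (simp del: mult_pCons_left add: degree_add_le)
qed simp

text \<open>Each stage multiplies by a monic linear factor and adds a constant, so the initial
  constant is carried to the top degree.\<close>

lemma coeff_moment_poly: "coeff (moment_poly n f) n = coeff f 0"
proof (induction n)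
  case (Suc n)
  have "coeff (moment_poly n f) (Suc n) = 0"
    using degree_moment_poly[of n f] by (simp add: coeff_eq_0)
  with Suc show ?case
    by simp
qed simp

text \<open>The point is the root of the linear factor of the last stage, so only the constant added
  there survives.\<close>

lemma poly_moment_poly_top: "poly (moment_poly n f) (- of_nat n - 1) = coeff f n"
  by (cases n) (auto simp: algebra_simps)

text \<open>Evaluation at the root of the last factor removes the top coefficient; cancelling that
  factor then leaves the same claim for \<open>n - 1\<close>.\<close>

lemma moment_poly_eq_0D:
  assumes "moment_poly n f = 0" "s \<le> n"
  shows "coeff f s = 0"
  using assms
proof (induction n)
  case (Suc n)
  have top: "coeff f (Suc n) = 0"
    using poly_moment_poly_top[of "Suc n" f] unfolding Suc.prems(1) poly_0 by simp
  then have "[:of_nat n + 2, 1:] * moment_poly n f = 0"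
    using Suc.prems by simp
  then have "moment_poly n f = 0"
    by (simp del: mult_pCons_left)
  then show ?case
    using Suc top by (cases "s = Suc n") auto
qed simp

lemma moment_poly_cong:
  assumes "\<And>s. s \<le> n \<Longrightarrow> coeff f s = coeff g s"
  shows "moment_poly n f = moment_poly n g"
  using assms by (induction n) auto

text \<open>The Horner scheme is run backwards: dividing by the last linear factor leaves the top
  coefficient as remainder and the previous stage as quotient.\<close>

lemma moment_poly_surj:
  assumes "degree q \<le> n"
  shows "\<exists>f. degree f \<le> n \<and> moment_poly n f = q"
  using assms
proof (induction n arbitrary: q)
  case 0
  then obtain c where "q = [:c:]"
    by (auto elim: degree_eq_zeroE)
  then show ?case
    by (intro exI[of _ "[:c:]"]) auto
next
  case (Suc n)
  define c where "c = poly q (- of_nat n - 2)"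
  have "[:of_nat n + 2, 1:] dvd q - [:c:]"
    using poly_eq_0_iff_dvd[of "q - [:c:]" "- of_nat n - 2"] by (simp add: c_def add.commute)
  then obtain r where r: "q - [:c:] = [:of_nat n + 2, 1:] * r"
    by (elim dvdE)
  have "degree r \<le> n"
  proof (cases "r = 0")
    case False
    have "degree (q - [:c:]) \<le> Suc n"
      using Suc.prems by (simp add: degree_diff_le)
    then show ?thesis
      using False unfolding r by (subst (asm) degree_mult_eq) auto
  qed simp
  then obtain f where f: "degree f \<le> n" "moment_poly n f = r"
    using Suc.IH by blast
  \<comment> \<open>The new monomial has degree \<open>Suc n\<close>, which
    \<open>moment_poly n\<close> does not see, so it changes only the last stage.\<close>
  define g where "g = f + monom c (Suc n)"
  have "degree g \<le> Suc n"
    unfolding g_def using f by (intro degree_add_le) (auto intro: degree_monom_le)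
  moreover have "moment_poly n g = r"
    using moment_poly_cong[of n g f] f by (simp add: g_def)
  moreover have "coeff g (Suc n) = c"
    using f by (simp add: g_def coeff_eq_0)
  ultimately show ?case
    using r by (intro exI[of _ g]) (simp del: mult_pCons_left add: r[symmetric])
qed

section \<open>Orthogonality at a sequence of nodes\<close>

definition moments_vanish :: "(nat \<Rightarrow> complex) \<Rightarrow> nat \<Rightarrow> complex poly \<Rightarrow> bool" where
  "moments_vanish x n f \<longleftrightarrow> (\<forall>k<n. gamma_moment (x k) f = 0)"

definition monic_orthogonal :: "(nat \<Rightarrow> complex) \<Rightarrow> nat \<Rightarrow> complex poly \<Rightarrow> bool" where
  "monic_orthogonal x n f \<longleftrightarrow> degree f = n \<and> coeff f n = 1 \<and> moments_vanish x n f"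

lemma is_MB_poly_iff_monic_orthogonal:
  "is_MB_poly p \<alpha> b n f \<longleftrightarrow> monic_orthogonal (theta_shift p \<alpha> b) n f"
proof -
  \<comment> \<open>This includes the poles, where \<open>Gamma\<close> has the value 0 and division
    by 0 yields 0.\<close>
  have "1 / Gamma z = rGamma z" for z :: complex
    by (simp only: rGamma_inverse_Gamma inverse_eq_divide)
  then show ?thesis
    unfolding is_MB_poly_def monic_orthogonal_def moments_vanish_def gamma_moment_def
    by (auto simp: theta_shift_def atMost_atLeast0)
qed

text \<open>Injectivity makes any \<open>n\<close> nodes distinct roots; the second condition keeps
  \<open>rGamma (x k + n + 2)\<close> nonzero. Abstract nodes let every shift of \<theta> be treated
  at once.\<close>

locale bessel_nodes =
  fixes x :: "nat \<Rightarrow> complex"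
  assumes inj_x: "inj x"
    and x_nonpole: "x k + 2 \<notin> \<int>\<^sub>\<le>\<^sub>0"
begin

lemma x_plus_nonpole: "x k + of_nat n + 2 \<notin> \<int>\<^sub>\<le>\<^sub>0"
proof
  assume "x k + of_nat n + 2 \<in> \<int>\<^sub>\<le>\<^sub>0"
  then have "(x k + of_nat n + 2) - of_nat n \<in> \<int>\<^sub>\<le>\<^sub>0"
    by (rule nonpos_Ints_diff_Nats) auto
  then show False
    using x_nonpole[of k] by simp
qed

lemma x_plus_neq_0: "x k + of_nat n + 2 \<noteq> 0"
  using x_plus_nonpole[of k n] by auto

text \<open>For \<open>n = 0\<close> the value \<open>x k + 1\<close> may vanish; products over
  \<open>k < n\<close> only have factors with \<open>n > 0\<close>.\<close>

lemma x_plus_1_neq_0: "n > 0 \<Longrightarrow> x k + of_nat n + 1 \<noteq> 0"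
  using x_plus_neq_0[of k "n - 1"] by (cases n) (auto simp: algebra_simps)

text \<open>The two sides have equal coefficients at degree \<open>n\<close>, so their difference
  has degree below \<open>n\<close> unless it is zero. It also vanishes at the \<open>n\<close>
  distinct nodes, hence it is zero.\<close>

lemma moments_vanish_moment_poly:
  assumes "degree f \<le> n" "moments_vanish x n f"
  shows "moment_poly n f = smult (coeff f 0) (\<Prod>k<n. [:- x k, 1:])"
proof -
  define w where "w = (\<Prod>k<n. [:- x k, 1:])"
  define q where "q = moment_poly n f - smult (coeff f 0) w"
  have deg_w: "degree w = n"
    by (simp add: w_def degree_prod_eq_sum_degree)
  moreover have "lead_coeff w = 1"
    by (simp add: w_def lead_coeff_prod)
  ultimately have "coeff q n = 0"
    by (simp add: q_def coeff_moment_poly)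
  moreover have "degree q \<le> n"
    unfolding q_def using deg_w by (intro degree_diff_le degree_moment_poly) simp
  ultimately have small: "q = 0 \<or> degree q < n"
    by (metis eq_zero_or_degree_less)
  have "poly q y = 0" if y: "y \<in> x ` {..<n}" for y
  proof -
    obtain k where k: "k < n" "y = x k"
      using y by auto
    \<comment> \<open>The moment is this value times a reciprocal Gamma value that is nonzero at a
      node.\<close>
    have "poly (moment_poly n f) y = 0"
      using assms k gamma_moment_eq_moment_poly[OF assms(1), of y] x_plus_nonpole[of k n]
      by (auto simp: moments_vanish_def rGamma_eq_zero_iff)
    moreover have "poly w y = 0"
      using k by (auto simp: w_def poly_prod)
    ultimately show ?thesis
      by (simp add: q_def)
  qed
  then have sub: "x ` {..<n} \<subseteq> {y. poly q y = 0}"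
    by auto
  have "q = 0"
  proof (rule ccontr)
    assume "q \<noteq> 0"
    then have "card (x ` {..<n}) \<le> degree q"
      using card_mono[OF poly_roots_finite sub] card_poly_roots_bound[of q] by linarith
    moreover have "card (x ` {..<n}) = n"
      using inj_x by (simp add: card_image inj_on_subset)
    ultimately show False
      using small \<open>q \<noteq> 0\<close> by simp
  qed
  then show ?thesis
    by (simp add: q_def w_def)
qed

lemma moments_vanish_eq_0:
  assumes "degree f \<le> n" "moments_vanish x n f" "coeff f 0 = 0"
  shows "f = 0"
proof (rule poly_eqI)
  fix s
  have "moment_poly n f = 0"
    using moments_vanish_moment_poly[OF assms(1,2)] assms(3) by simp
  then show "coeff f s = coeff 0 s"
    using moment_poly_eq_0D[of n f s] assms(1) by (cases "s \<le> n") (auto simp: coeff_eq_0)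
qed

lemma node_prod_neq_0: "(\<Prod>k<n. x k + of_nat n + 1) \<noteq> 0"
  using x_plus_1_neq_0 by auto

lemma poly_node_prod: "poly (\<Prod>k<n. [:- x k, 1:]) (- of_nat n - 1)
    = (-1) ^ n * (\<Prod>k<n. x k + of_nat n + 1)"
proof -
  have "poly (\<Prod>k<n. [:- x k, 1:]) (- of_nat n - 1) = (\<Prod>k<n. (-1) * (x k + of_nat n + 1))"
    unfolding poly_prod by (rule prod.cong) (auto simp: algebra_simps)
  then show ?thesis
    by (simp only: prod.distrib prod_constant card_lessThan)
qed

text \<open>Both forms of the moment polynomial are evaluated at \<open>- n - 1\<close>, where the
  value is the leading coefficient 1.\<close>

lemma coeff_0_monic_orthogonal:
  assumes "monic_orthogonal x n f"
  shows "coeff f 0 = (-1) ^ n / (\<Prod>k<n. x k + of_nat n + 1)"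
proof -
  have "moment_poly n f = smult (coeff f 0) (\<Prod>k<n. [:- x k, 1:])"
    using assms by (intro moments_vanish_moment_poly) (auto simp: monic_orthogonal_def)
  then have "coeff f 0 * ((-1) ^ n * (\<Prod>k<n. x k + of_nat n + 1)) = 1"
    using poly_moment_poly_top[of n f] assms
    by (simp add: poly_node_prod monic_orthogonal_def)
  then have "(coeff f 0 * (\<Prod>k<n. x k + of_nat n + 1)) * ((-1) ^ n * (-1) ^ n) = (-1) ^ n"
    by (metis mult.assoc mult.left_commute mult_1_right)
  then show ?thesis
    using node_prod_neq_0[of n] by (simp add: eq_divide_eq flip: power_add)
qed

lemma monic_orthogonal_unique:
  assumes "monic_orthogonal x n f" "monic_orthogonal x n g"
  shows "f = g"
proof -
  have "f - g = 0"
  proof (rule moments_vanish_eq_0)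
    show "degree (f - g) \<le> n"
      using assms by (intro degree_diff_le) (auto simp: monic_orthogonal_def)
    show "moments_vanish x n (f - g)"
      using assms by (auto simp: monic_orthogonal_def moments_vanish_def gamma_moment_diff)
    show "coeff (f - g) 0 = 0"
      using assms by (simp add: coeff_0_monic_orthogonal)
  qed
  then show ?thesis
    by simp
qed

lemma monic_orthogonal_exists: "\<exists>f. monic_orthogonal x n f"
proof -
  \<comment> \<open>The scaling makes \<open>q\<close> equal to 1 at \<open>- n - 1\<close>, so that
    its preimage \<open>f\<close> has top coefficient 1.\<close>
  define c where "c = 1 / ((-1) ^ n * (\<Prod>k<n. x k + of_nat n + 1))"
  define q where "q = smult c (\<Prod>k<n. [:- x k, 1:])"
  have "degree q \<le> n"
    unfolding q_def by (rule order.trans[OF degree_smult_le]) (simp add: degree_prod_eq_sum_degree)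
  then obtain f where f: "degree f \<le> n" "moment_poly n f = q"
    using moment_poly_surj by blast
  have lead: "coeff f n = 1"
    using poly_moment_poly_top[of n f] f(2) node_prod_neq_0[of n]
    by (simp add: q_def c_def poly_node_prod)
  then have "degree f = n"
    using f(1) le_degree[of f n] by simp
  moreover have "moments_vanish x n f"
    using f gamma_moment_eq_moment_poly[OF f(1)]
    by (auto simp: moments_vanish_def q_def poly_prod)
  ultimately show ?thesis
    using lead by (auto simp: monic_orthogonal_def)
qed

lemma monic_orthogonal_ex1: "\<exists>!f. monic_orthogonal x n f"
  by (intro ex_ex1I monic_orthogonal_exists) (rule monic_orthogonal_unique)

lemma coeff_0_monic_orthogonal_neq_0:
  assumes "monic_orthogonal x n f"
  shows "coeff f 0 \<noteq> 0"
  using coeff_0_monic_orthogonal[OF assms] node_prod_neq_0[of n] by simp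

text \<open>Subtracting the multiple of \<open>g\<close> with the same value at 0 leaves an element
  of the orthogonal space with constant term 0. This comparison underlies both connection
  formulas.\<close>

lemma orthogonal_eq_smult:
  assumes "degree f \<le> n" "moments_vanish x n f" "monic_orthogonal x n g"
  shows "f = smult (coeff f 0 / coeff g 0) g"
proof -
  define c where "c = coeff f 0 / coeff g 0"
  have "f - smult c g = 0"
  proof (rule moments_vanish_eq_0)
    show "degree (f - smult c g) \<le> n"
      using assms degree_smult_le[of c g]
      by (intro degree_diff_le) (auto simp: monic_orthogonal_def)
    show "moments_vanish x n (f - smult c g)"
      using assms
      by (auto simp: monic_orthogonal_def moments_vanish_def gamma_moment_diff gamma_moment_smult)
    show "coeff (f - smult c g) 0 = 0"
      using coeff_0_monic_orthogonal_neq_0[OF assms(3)] by (simp add: c_def)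
  qed
  then show ?thesis
    by (simp add: c_def)
qed

section \<open>Vandermonde-Gamma quotients at the nodes\<close>

lemma scrD_neq_0: "scrD n x \<noteq> 0"
proof -
  have "x t \<noteq> x s" if "s < t" for s t
    using inj_x that by (auto dest: injD)
  moreover have "Gamma (x s + of_nat n + 1) \<noteq> 0" if "s < n" for s
    using x_plus_nonpole[of s "n - 1"] that by (cases n) (auto simp: Gamma_eq_zero_iff algebra_simps)
  ultimately show ?thesis
    by (auto simp: scrD_def)
qed

text \<open>The sign and the differences are invariant under translation; each Gamma factor gains
  \<open>x s + n + 1\<close> by the functional equation.\<close>

lemma scrD_eq_scrD_plus_1:
  "scrD n x = scrD n (\<lambda>k. x k + 1) * (\<Prod>k<n. x k + of_nat n + 1)"
proof -
  have G: "Gamma (x s + of_nat n + 1) \<noteq> 0 \<and> Gamma (x s + 1 + of_nat n + 1)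
      = (x s + of_nat n + 1) * Gamma (x s + of_nat n + 1)" if "s < n" for s
  proof -
    have np: "x s + of_nat n + 1 \<notin> \<int>\<^sub>\<le>\<^sub>0"
      using x_plus_nonpole[of s "n - 1"] that by (cases n) (auto simp: algebra_simps)
    have e: "x s + 1 + of_nat n + 1 = (x s + of_nat n + 1) + 1"
      by simp
    show ?thesis
      unfolding e using np Gamma_plus1[OF np] by (auto simp only: Gamma_eq_zero_iff)
  qed
  then have "(\<Prod>s<n. Gamma (x s + 1 + of_nat n + 1))
      = (\<Prod>s<n. x s + of_nat n + 1) * (\<Prod>s<n. Gamma (x s + of_nat n + 1))"
    by (subst prod.distrib[symmetric], intro prod.cong) auto
  then show ?thesis
    using node_prod_neq_0[of n] G by (simp add: scrD_def)
qed

end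

section \<open>Connection formulas between neighbouring families\<close>

lemma monic_orthogonal_nodes_shift:
  assumes "bessel_nodes x" "bessel_nodes (\<lambda>k. x (Suc k))"
    and "monic_orthogonal x (Suc n) f"
    and "monic_orthogonal (\<lambda>k. x (Suc k)) (Suc n) g"
    and "monic_orthogonal (\<lambda>k. x (Suc k)) n h"
  shows "f = g + smult ((coeff f 0 - coeff g 0) / coeff h 0) h"
proof -
  \<comment> \<open>The leading terms cancel, and the nodes shared by \<open>f\<close> and
    \<open>g\<close> are \<open>x 1, ..., x n\<close>, exactly those of \<open>h\<close>.\<close>
  have "f - g = smult (coeff (f - g) 0 / coeff h 0) h"
  proof (rule bessel_nodes.orthogonal_eq_smult[OF assms(2) _ _ assms(5)])
    have "degree (f - g) \<le> Suc n" "coeff (f - g) (Suc n) = 0"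
      using assms by (auto simp: monic_orthogonal_def degree_diff_le)
    then show "degree (f - g) \<le> n"
      by (metis degree_0 eq_zero_or_degree_less le0 less_Suc_eq_le)
    show "moments_vanish (\<lambda>k. x (Suc k)) n (f - g)"
      using assms by (auto simp: monic_orthogonal_def moments_vanish_def gamma_moment_diff)
  qed
  then show ?thesis
    by (metis add.commute coeff_diff diff_add_cancel)
qed

text \<open>Multiplication by the variable turns vanishing at \<open>x k + 1\<close> into vanishing
  at \<open>x k\<close>. The product is monic of degree \<open>n + 1\<close> with value 0 at the
  origin, so its difference from \<open>g\<close> is the multiple of \<open>h\<close> with value
  \<open>g(0)\<close>.\<close>

lemma monic_orthogonal_nodes_plus_1:
  assumes "bessel_nodes x"
    and "monic_orthogonal (\<lambda>k. x k + 1) n f"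
    and "monic_orthogonal x (Suc n) g"
    and "monic_orthogonal x n h"
  shows "[:0, 1:] * f = g + smult (- (coeff g 0 / coeff h 0)) h"
proof -
  have "f \<noteq> 0"
    using assms(2) by (auto simp: monic_orthogonal_def)
  define d where "d = g - pCons 0 f"
  have "d = smult (coeff d 0 / coeff h 0) h"
  proof (rule bessel_nodes.orthogonal_eq_smult[OF assms(1) _ _ assms(4)])
    have "degree d \<le> Suc n" "coeff d (Suc n) = 0"
      using assms \<open>f \<noteq> 0\<close> by (auto simp: d_def monic_orthogonal_def degree_diff_le)
    then show "degree d \<le> n"
      by (metis degree_0 eq_zero_or_degree_less le0 less_Suc_eq_le)
    show "moments_vanish x n d"
      using assms
      by (auto simp: d_def monic_orthogonal_def moments_vanish_def gamma_moment_diff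
          gamma_moment_pCons_0)
  qed
  moreover have "coeff d 0 = coeff g 0"
    by (simp add: d_def)
  ultimately show ?thesis
    by (simp add: d_def algebra_simps)
qed

section \<open>Banded matrices and polynomial families\<close>

text \<open>Row \<open>n\<close> of \<open>B\<close> holds the coordinates of \<open>f n\<close>.
  The bound \<open>Suc n\<close> on the band survives left multiplication by lower bidiagonal
  matrices.\<close>

definition expands_in :: "(nat \<Rightarrow> complex poly) \<Rightarrow> inf_matrix \<Rightarrow> (nat \<Rightarrow> complex poly) \<Rightarrow> bool" where
  "expands_in P B f \<longleftrightarrow>
     (\<forall>n. (\<forall>m>Suc n. B n m = 0) \<and> f n = (\<Sum>m\<le>Suc n. smult (B n m) (P m)))"

lemma inf_mult_lower_bidiagonal:
  "inf_mult (lower_bidiagonal c) B 0 m = B 0 m"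
  "inf_mult (lower_bidiagonal c) B (Suc n) m = B (Suc n) m + c n * B n m"
proof -
  have "inf_mult (lower_bidiagonal c) B n m = (\<Sum>k\<le>n. lower_bidiagonal c n k * B k m)" for n
    unfolding inf_mult_def
    by (rule sum.mono_neutral_left) (auto simp: lower_bidiagonal_def split: if_splits)
  note expand = this
  show "inf_mult (lower_bidiagonal c) B 0 m = B 0 m"
    by (subst expand) (simp add: lower_bidiagonal_def)
  have "(\<Sum>k\<le>n. lower_bidiagonal c (Suc n) k * B k m) = (\<Sum>k\<in>{n}. c k * B k m)"
    by (rule sum.mono_neutral_cong_right) (auto simp: lower_bidiagonal_def)
  then show "inf_mult (lower_bidiagonal c) B (Suc n) m = B (Suc n) m + c n * B n m"
    by (subst expand) (simp add: lower_bidiagonal_def)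
qed

text \<open>A two-term relation between families acts on coordinate rows as a left bidiagonal
  factor.\<close>

lemma expands_in_lower_bidiagonal:
  assumes B: "expands_in P B f" and "g 0 = f 0" and "\<And>n. g (Suc n) = f (Suc n) + smult (c n) (f n)"
  shows "expands_in P (inf_mult (lower_bidiagonal c) B) g"
  unfolding expands_in_def
proof
  fix n
  show "(\<forall>m>Suc n. inf_mult (lower_bidiagonal c) B n m = 0) \<and>
      g n = (\<Sum>m\<le>Suc n. smult (inf_mult (lower_bidiagonal c) B n m) (P m))"
  proof (cases n)
    case 0
    with B assms(2) show ?thesis
      by (auto simp: expands_in_def inf_mult_lower_bidiagonal)
  next
    case (Suc k)
    have zero: "B k m = 0" if "m > Suc k" for m
      using B that by (simp add: expands_in_def)
    \<comment> \<open>Row \<open>k\<close> is padded by one zero entry, to match the range of row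
      \<open>Suc k\<close>.\<close>
    have "f k = (\<Sum>m\<le>Suc (Suc k). smult (B k m) (P m))"
      using B zero[of "Suc (Suc k)"] by (simp add: expands_in_def)
    moreover have "f (Suc k) = (\<Sum>m\<le>Suc (Suc k). smult (B (Suc k) m) (P m))"
      using B by (simp only: expands_in_def)
    moreover have "smult a (sum h A) = (\<Sum>m\<in>A. smult a (h m))"
      for a and h :: "nat \<Rightarrow> complex poly" and A
      by (induction A rule: infinite_finite_induct) (auto simp: smult_add_right)
    ultimately have "g (Suc k) = (\<Sum>m\<le>Suc (Suc k). smult (B (Suc k) m + c k * B k m) (P m))"
      by (simp only: assms(3) smult_add_left sum.distrib smult_smult)
    moreover have "B (Suc k) m = 0" if "m > Suc (Suc k)" for m
      using B that by (simp add: expands_in_def)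
    ultimately show ?thesis
      using zero by (simp add: Suc inf_mult_lower_bidiagonal)
  qed
qed

lemma expands_in_upper_bidiagonal:
  assumes "\<And>n. f n = P (Suc n) + smult (d n) (P n)"
  shows "expands_in P (upper_bidiagonal d) f"
proof -
  have "(\<Sum>m\<le>n. smult (upper_bidiagonal d n m) (P m)) = (\<Sum>m\<in>{n}. smult (d m) (P m))" for n
    by (rule sum.mono_neutral_cong_right) (auto simp: upper_bidiagonal_def)
  then show ?thesis
    using assms by (auto simp: expands_in_def upper_bidiagonal_def)
qed

section \<open>Existence and uniqueness of the recurrence matrix\<close>

lemma is_recurrence_matrix_if_expands_in:
  assumes "expands_in P B (\<lambda>n. [:0, 1:] * P n)"
  shows "is_recurrence_matrix P B"
  unfolding is_recurrence_matrix_def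
proof
  fix n
  have sub: "{m. B n m \<noteq> 0} \<subseteq> {..Suc n}"
    using assms by (auto simp: expands_in_def) (meson not_le)
  have "(\<Sum>m | B n m \<noteq> 0. smult (B n m) (P m)) = (\<Sum>m\<le>Suc n. smult (B n m) (P m))"
    using sub by (intro sum.mono_neutral_left) auto
  then show "finite {m. B n m \<noteq> 0} \<and>
      [:0, 1:] * P n = (\<Sum>m | B n m \<noteq> 0. smult (B n m) (P m))"
    using assms finite_subset[OF sub] unfolding expands_in_def by simp
qed

text \<open>Only the last summand reaches the top degree, so its scalar vanishes and the sum
  shortens.\<close>

lemma graded_independent:
  fixes P :: "nat \<Rightarrow> complex poly"
  assumes deg: "\<And>m. degree (P m) = m" "\<And>m. coeff (P m) m = 1"
    and "(\<Sum>m<N. smult (a m) (P m)) = 0" "m < N"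
  shows "a m = 0"
  using assms(3,4)
proof (induction N)
  case (Suc N)
  have "coeff (\<Sum>m<N. smult (a m) (P m)) N = 0"
    using deg by (auto simp: coeff_sum coeff_eq_0 intro!: sum.neutral)
  moreover have "coeff (\<Sum>m<Suc N. smult (a m) (P m)) N = 0"
    by (simp only: Suc.prems coeff_0)
  ultimately have "a N = 0"
    using deg by simp
  with Suc show ?case
    by (cases "m = N") auto
qed simp

lemma is_recurrence_matrix_unique:
  assumes deg: "\<And>m. degree (P m) = m" "\<And>m. coeff (P m) m = 1"
    and S: "is_recurrence_matrix P S" and T: "is_recurrence_matrix P T"
  shows "S = T"
proof (intro ext)
  fix n m
  \<comment> \<open>Including \<open>m\<close> itself gives \<open>m < N\<close> even when both
    entries in that column are zero.\<close>
  have fin: "finite ({m. S n m \<noteq> 0} \<union> {m. T n m \<noteq> 0} \<union> {m})"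
    using S T by (simp add: is_recurrence_matrix_def)
  then obtain N where N: "{m. S n m \<noteq> 0} \<union> {m. T n m \<noteq> 0} \<union> {m} \<subseteq> {..<N}"
    using finite_nat_iff_bounded by blast
  have "(\<Sum>m<N. smult (S n m) (P m)) = (\<Sum>m | S n m \<noteq> 0. smult (S n m) (P m))"
    using N by (intro sum.mono_neutral_right) auto
  moreover have "(\<Sum>m<N. smult (T n m) (P m)) = (\<Sum>m | T n m \<noteq> 0. smult (T n m) (P m))"
    using N by (intro sum.mono_neutral_right) auto
  ultimately have "(\<Sum>m<N. smult (S n m - T n m) (P m)) = 0"
    using S T unfolding is_recurrence_matrix_def smult_diff_left sum_subtractf
    by (metis diff_self)
  then have "S n m - T n m = 0"
    using N by (intro graded_independent[OF deg, where a = "\<lambda>m. S n m - T n m"]) auto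
  then show "S n m = T n m"
    by simp
qed

section \<open>The step-line multiple Bessel polynomials\<close>

locale multiple_bessel =
  fixes p :: nat and \<alpha> :: "nat \<Rightarrow> complex"
  assumes p_pos: "p \<ge> 1"
    and non_integer_diff: "\<forall>i\<in>{1..p}. \<forall>h\<in>{1..p}. i \<noteq> h \<longrightarrow> \<alpha> i - \<alpha> h \<notin> \<int>"
    and nonpole: "\<forall>j\<in>{1..p}. \<alpha> j + 2 \<notin> \<int>\<^sub>\<le>\<^sub>0"
begin

lemma theta_eq: "theta p \<alpha> i = \<alpha> (i mod p + 1) + of_nat (i div p)"
  by (simp add: theta_def alpha_ext_def)

lemma mod_in: "i mod p + 1 \<in> {1..p}"
  using p_pos mod_less_divisor[of p i] by (auto simp del: mod_less_divisor)

text \<open>Equal values make a difference of two parameters an integer, so the residues mod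
  \<open>p\<close> agree; the integer shifts then give equal quotients.\<close>

lemma inj_theta: "inj (theta p \<alpha>)"
proof (rule injI)
  fix i j
  assume eq: "theta p \<alpha> i = theta p \<alpha> j"
  then have "\<alpha> (i mod p + 1) - \<alpha> (j mod p + 1) = of_nat (j div p) - of_nat (i div p)"
    by (simp add: theta_eq algebra_simps)
  then have "\<alpha> (i mod p + 1) - \<alpha> (j mod p + 1) \<in> \<int>"
    by simp
  then have "i mod p = j mod p"
    using non_integer_diff mod_in by (metis add_right_cancel)
  moreover from this have "i div p = j div p"
    using eq by (simp add: theta_eq)
  ultimately show "i = j"
    by (metis div_mult_mod_eq)
qed

lemma theta_nonpole: "theta p \<alpha> i + 2 \<notin> \<int>\<^sub>\<le>\<^sub>0"
proof
  assume "theta p \<alpha> i + 2 \<in> \<int>\<^sub>\<le>\<^sub>0"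
  then have "(theta p \<alpha> i + 2) - of_nat (i div p) \<in> \<int>\<^sub>\<le>\<^sub>0"
    by (rule nonpos_Ints_diff_Nats) auto
  then show False
    using nonpole mod_in[of i] by (simp add: theta_eq)
qed

lemma bessel_nodes_theta_shift: "bessel_nodes (theta_shift p \<alpha> b)"
proof
  show "inj (theta_shift p \<alpha> b)"
    by (rule injI) (auto simp: theta_shift_def dest: injD[OF inj_theta])
qed (simp add: theta_shift_def theta_nonpole)

lemma theta_shift_0: "theta_shift p \<alpha> 0 = theta p \<alpha>"
  by (simp add: theta_shift_def fun_eq_iff)

lemma theta_shift_Suc: "theta_shift p \<alpha> (Suc b) = (\<lambda>k. theta_shift p \<alpha> b (Suc k))"
  by (simp add: theta_shift_def fun_eq_iff)

lemma theta_shift_p_eq: "theta_shift p \<alpha> p = (\<lambda>k. theta p \<alpha> k + 1)"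
  using theta_shift_p[OF p_pos] by blast

lemma MB_poly_ex1: "\<exists>!f. is_MB_poly p \<alpha> b n f"
  unfolding is_MB_poly_iff_monic_orthogonal
  by (rule bessel_nodes.monic_orthogonal_ex1[OF bessel_nodes_theta_shift])

lemma MB_poly_monic_orthogonal: "monic_orthogonal (theta_shift p \<alpha> b) n (MB_poly p \<alpha> b n)"
  unfolding MB_poly_def is_MB_poly_iff_monic_orthogonal[symmetric]
  by (rule theI'[OF MB_poly_ex1])

lemma degree_MB_poly: "degree (MB_poly p \<alpha> b n) = n"
  and lead_coeff_MB_poly: "coeff (MB_poly p \<alpha> b n) n = 1"
  using MB_poly_monic_orthogonal[of b n] by (auto simp: monic_orthogonal_def)

lemma MB_poly_0: "MB_poly p \<alpha> b 0 = 1"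
  using degree_0_id[OF degree_MB_poly[of b 0]] lead_coeff_MB_poly[of b 0] by (metis pCons_one)

lemma poly_0_MB_poly:
  "poly (MB_poly p \<alpha> b n) 0 = (-1) ^ n / (\<Prod>k<n. theta p \<alpha> (b + k) + of_nat n + 1)"
  using bessel_nodes.coeff_0_monic_orthogonal[OF bessel_nodes_theta_shift MB_poly_monic_orthogonal]
  by (simp add: poly_0_coeff_0 theta_shift_def)

lemma poly_0_MB_poly_neq_0: "poly (MB_poly p \<alpha> b n) 0 \<noteq> 0"
  using bessel_nodes.coeff_0_monic_orthogonal_neq_0
    [OF bessel_nodes_theta_shift MB_poly_monic_orthogonal]
  by (simp add: poly_0_coeff_0)

lemma theta_plus_neq_0: "theta p \<alpha> i + of_nat n + 2 \<noteq> 0"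
  using bessel_nodes.x_plus_neq_0[OF bessel_nodes_theta_shift[of 0]] by (simp add: theta_shift_0)

lemma MB_poly_shift:
  "MB_poly p \<alpha> a (Suc n) = MB_poly p \<alpha> (Suc a) (Suc n) +
     smult ((poly (MB_poly p \<alpha> a (Suc n)) 0 - poly (MB_poly p \<alpha> (Suc a) (Suc n)) 0)
       / poly (MB_poly p \<alpha> (Suc a) n) 0) (MB_poly p \<alpha> (Suc a) n)"
  unfolding poly_0_coeff_0
proof (rule monic_orthogonal_nodes_shift[OF bessel_nodes_theta_shift[of a] _
      MB_poly_monic_orthogonal])
  show "bessel_nodes (\<lambda>k. theta_shift p \<alpha> a (Suc k))"
    using bessel_nodes_theta_shift[of "Suc a"] by (simp only: theta_shift_Suc)
  show "monic_orthogonal (\<lambda>k. theta_shift p \<alpha> a (Suc k)) (Suc n) (MB_poly p \<alpha> (Suc a) (Suc n))"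
    "monic_orthogonal (\<lambda>k. theta_shift p \<alpha> a (Suc k)) n (MB_poly p \<alpha> (Suc a) n)"
    using MB_poly_monic_orthogonal[of "Suc a"] by (simp_all only: theta_shift_Suc)
qed

text \<open>Shifting by a full period \<open>p\<close> adds 1 to every node, which closes the chain
  of families back to the one with \<open>b = 0\<close>.\<close>

lemma MB_poly_times_X:
  "[:0, 1:] * MB_poly p \<alpha> p n = MB_poly p \<alpha> 0 (Suc n) +
     smult (- (poly (MB_poly p \<alpha> 0 (Suc n)) 0 / poly (MB_poly p \<alpha> 0 n) 0)) (MB_poly p \<alpha> 0 n)"
  unfolding poly_0_coeff_0
proof (rule monic_orthogonal_nodes_plus_1[OF bessel_nodes_theta_shift[of 0] _
      MB_poly_monic_orthogonal MB_poly_monic_orthogonal])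
  show "monic_orthogonal (\<lambda>k. theta_shift p \<alpha> 0 k + 1) n (MB_poly p \<alpha> p n)"
    using MB_poly_monic_orthogonal[of p n] by (simp add: theta_shift_0 theta_shift_p_eq)
qed

text \<open>Descending induction on \<open>a\<close>: the empty list at \<open>a = p\<close> leaves
  the upper factor, each step to a smaller \<open>a\<close> prepends one lower factor, and
  \<open>a = 0\<close> gives the full product.\<close>

lemma expands_in_partial_product:
  assumes "a \<le> p"
  shows "expands_in (MB_poly p \<alpha> 0)
      (foldr inf_mult (map (L_tilde p \<alpha>) [Suc a..<Suc p]) (U_tilde p \<alpha>))
      (\<lambda>n. [:0, 1:] * MB_poly p \<alpha> a n)"
  using assms
proof (induction a rule: inc_induct)
  case base
  show ?case
    using MB_poly_times_X by (simp add: U_tilde_def expands_in_upper_bidiagonal del: mult_pCons_left)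
next
  case (step a)
  have split: "[Suc a..<Suc p] = Suc a # [Suc (Suc a)..<Suc p]"
    using step.hyps by (subst upt_conv_Cons) auto
  define c where "c = (\<lambda>n. (poly (MB_poly p \<alpha> a (n + 1)) 0 - poly (MB_poly p \<alpha> (Suc a) (n + 1)) 0)
       / poly (MB_poly p \<alpha> (Suc a) n) 0)"
  have L: "L_tilde p \<alpha> (Suc a) = lower_bidiagonal c"
    by (simp only: L_tilde_def c_def diff_Suc_1)
  have shift: "[:0, 1:] * MB_poly p \<alpha> a (Suc n) = [:0, 1:] * MB_poly p \<alpha> (Suc a) (Suc n) +
     smult (c n) ([:0, 1:] * MB_poly p \<alpha> (Suc a) n)" for n
    by (subst MB_poly_shift) (simp only: distrib_left mult_smult_right c_def Suc_eq_plus1)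
  show ?case
    unfolding split list.map foldr.simps comp_apply L
  proof (rule expands_in_lower_bidiagonal[OF step.IH])
    \<comment> \<open>All families start with the constant 1, so the first row is unchanged.\<close>
    show "[:0, 1:] * MB_poly p \<alpha> a 0 = [:0, 1:] * MB_poly p \<alpha> (Suc a) 0"
      by (simp only: MB_poly_0)
  qed (rule shift)
qed

lemma is_recurrence_matrix_product:
  "is_recurrence_matrix (MB_poly p \<alpha> 0)
     (foldr inf_mult (map (L_tilde p \<alpha>) [1..<p + 1]) (U_tilde p \<alpha>))"
  using is_recurrence_matrix_if_expands_in[OF expands_in_partial_product[of 0]] by simp

lemma recurrence_matrix_ex1: "\<exists>!T. is_recurrence_matrix (MB_poly p \<alpha> 0) T"
proof (rule ex_ex1I)
  show "\<exists>T. is_recurrence_matrix (MB_poly p \<alpha> 0) T"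
    using is_recurrence_matrix_product by blast
qed (rule is_recurrence_matrix_unique[OF degree_MB_poly lead_coeff_MB_poly])

lemma T_MB_eq:
  "T_MB p \<alpha> = foldr inf_mult (map (L_tilde p \<alpha>) [1..<p + 1]) (U_tilde p \<alpha>)"
proof (rule is_recurrence_matrix_unique[OF degree_MB_poly lead_coeff_MB_poly])
  show "is_recurrence_matrix (MB_poly p \<alpha> 0) (T_MB p \<alpha>)"
    unfolding T_MB_def by (rule theI'[OF recurrence_matrix_ex1])
qed (rule is_recurrence_matrix_product)

section \<open>Closed forms of the bidiagonal entries\<close>

lemma L_tilde_subdiagonal:
  "L_tilde p \<alpha> (a + 1) (n + 1) n =
     (1 / (theta p \<alpha> (a + n + 1) + of_nat n + 2) - 1 / (theta p \<alpha> a + of_nat n + 2)) *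
     (\<Prod>s=1..n. (theta p \<alpha> (a + s) + of_nat n + 1) / (theta p \<alpha> (a + s) + of_nat n + 2))"
proof -
  \<comment> \<open>The two polynomials of degree \<open>n + 1\<close> share the factors collected
    in \<open>M\<close>; \<open>A\<close> and \<open>B\<close> belong to the first and last node,
    and \<open>N\<close> comes from degree \<open>n\<close>.\<close>
  define A where "A = theta p \<alpha> a + of_nat n + 2"
  define B where "B = theta p \<alpha> (a + n + 1) + of_nat n + 2"
  define M where "M = (\<Prod>s=1..n. theta p \<alpha> (a + s) + of_nat n + 2)"
  define N where "N = (\<Prod>s=1..n. theta p \<alpha> (a + s) + of_nat n + 1)"
  have reindex: "(\<Prod>k<n. f (Suc k)) = prod f {1..n}" for f :: "nat \<Rightarrow> complex"
    using prod.atLeast1_atMost_eq[of f n] by simp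
  have nz: "A \<noteq> 0" "B \<noteq> 0" "M \<noteq> 0"
    using theta_plus_neq_0 by (auto simp: A_def B_def M_def)
  have "(\<Prod>k<Suc n. theta p \<alpha> (a + k) + of_nat (Suc n) + 1) = A * M"
    unfolding A_def M_def reindex[symmetric]
    by (subst prod.lessThan_Suc_shift) (simp add: algebra_simps)
  moreover have "(\<Prod>k<Suc n. theta p \<alpha> (Suc a + k) + of_nat (Suc n) + 1) = M * B"
    unfolding B_def M_def reindex[symmetric]
    by (subst prod.lessThan_Suc) (simp add: algebra_simps)
  moreover have "(\<Prod>k<n. theta p \<alpha> (Suc a + k) + of_nat n + 1) = N"
    unfolding N_def reindex[symmetric] by (simp add: algebra_simps)
  ultimately have "L_tilde p \<alpha> (a + 1) (n + 1) n
      = ((-1) ^ Suc n / (A * M) - (-1) ^ Suc n / (M * B)) / ((-1) ^ n / N)"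
    by (simp only: L_tilde_def lower_bidiagonal_def poly_0_MB_poly Suc_eq_plus1[symmetric]
        diff_Suc_1) simp
  also have "\<dots> = (1 / B - 1 / A) * (N / M)"
    using nz by (simp add: field_simps)
  finally show ?thesis
    by (simp add: A_def B_def M_def N_def prod_dividef)
qed

lemma U_tilde_diagonal:
  "U_tilde p \<alpha> n n = (scrD n (theta p \<alpha>) * scrD (n + 1) (theta_shift p \<alpha> p)) /
     (scrD (n + 1) (theta p \<alpha>) * scrD n (theta_shift p \<alpha> p))"
proof -
  define D where "D = (\<lambda>k. scrD k (theta_shift p \<alpha> p))"
  define M where "M = (\<lambda>k. \<Prod>i<k. theta p \<alpha> i + of_nat k + 1)"
  have D: "D k \<noteq> 0" for k
    unfolding D_def by (rule bessel_nodes.scrD_neq_0[OF bessel_nodes_theta_shift])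
  have M: "M k \<noteq> 0" for k
    using bessel_nodes.node_prod_neq_0[OF bessel_nodes_theta_shift[of 0]]
    by (simp add: M_def theta_shift_0)
  \<comment> \<open>\<open>M k\<close> is, up to sign, the reciprocal of the value at 0 in degree
    \<open>k\<close>, which links the two forms of the diagonal entry.\<close>
  have S: "scrD k (theta p \<alpha>) = D k * M k" for k
    using bessel_nodes.scrD_eq_scrD_plus_1[OF bessel_nodes_theta_shift[of 0], of k]
    by (simp add: D_def M_def theta_shift_0 theta_shift_p_eq)
  have "U_tilde p \<alpha> n n = - (((-1) ^ (n + 1) / M (n + 1)) / ((-1) ^ n / M n))"
    by (simp only: U_tilde_def upper_bidiagonal_def poly_0_MB_poly M_def add_0) simp
  also have "\<dots> = M n / M (n + 1)"
    by simp
  also have "\<dots> = (D n * M n * D (n + 1)) / (D (n + 1) * M (n + 1) * D n)"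
    using D M by simp
  finally show ?thesis
    by (simp only: S D_def)
qed

end

theorem theorem8p4:
  fixes p :: nat and \<alpha> :: "nat \<Rightarrow> complex"
  assumes "p \<ge> 1"
    and "\<forall>i\<in>{1..p}. \<forall>h\<in>{1..p}. i \<noteq> h \<longrightarrow> \<alpha> i - \<alpha> h \<notin> \<int>"
    and "\<forall>j\<in>{1..p}. \<alpha> j + 2 \<notin> \<int>\<^sub>\<le>\<^sub>0"
  shows
    \<comment> \<open>the objects are well defined and no denominator vanishes\<close>
    "(\<forall>b\<le>p. \<forall>n. \<exists>!P. is_MB_poly p \<alpha> b n P) \<and>
     (\<exists>!T. is_recurrence_matrix (MB_poly p \<alpha> 0) T) \<and>
     (\<forall>b\<le>p. \<forall>n. poly (MB_poly p \<alpha> b n) 0 \<noteq> 0) \<and>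
     (\<forall>i n. theta p \<alpha> i + of_nat n + 2 \<noteq> 0) \<and>
     (\<forall>n. scrD n (theta p \<alpha>) \<noteq> 0 \<and> scrD n (theta_shift p \<alpha> p) \<noteq> 0) \<and>
     T_MB p \<alpha> = foldr inf_mult (map (L_tilde p \<alpha>) [1..<p + 1]) (U_tilde p \<alpha>) \<and>
     (\<forall>a<p. \<forall>n. L_tilde p \<alpha> (a + 1) (n + 1) n =
        (1 / (theta p \<alpha> (a + n + 1) + of_nat n + 2) - 1 / (theta p \<alpha> a + of_nat n + 2)) *
        (\<Prod>s=1..n. (theta p \<alpha> (a + s) + of_nat n + 1) / (theta p \<alpha> (a + s) + of_nat n + 2))) \<and>
     (\<forall>n. U_tilde p \<alpha> n n =
        (scrD n (theta p \<alpha>) * scrD (n + 1) (theta_shift p \<alpha> p)) /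
        (scrD (n + 1) (theta p \<alpha>) * scrD n (theta_shift p \<alpha> p)))"
proof -
  interpret multiple_bessel p \<alpha>
    using assms by (rule multiple_bessel.intro)
  have "scrD n (theta p \<alpha>) \<noteq> 0" for n
    using bessel_nodes.scrD_neq_0[OF bessel_nodes_theta_shift[of 0]] by (simp add: theta_shift_0)
  moreover have "scrD n (theta_shift p \<alpha> p) \<noteq> 0" for n
    by (rule bessel_nodes.scrD_neq_0[OF bessel_nodes_theta_shift])
  ultimately show ?thesis
    by (intro conjI allI impI MB_poly_ex1 recurrence_matrix_ex1 poly_0_MB_poly_neq_0
        theta_plus_neq_0 T_MB_eq L_tilde_subdiagonal U_tilde_diagonal)
qed

end
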